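(* Let $G$ be a non-empty proper subset of $\mathbb{N}_0$, let $A=\mathbb{N}_0\setminus G$, assume $A\setminus\{0\}\neq\emptyset$, and let $m=\min(A\setminus\{0\})$. Put $h_0=m$ and $h_i=\inf([i]_m^{A})$ for $i\in\{1,2,\ldots,m-1\}$. Then $A$ is a semigroup (that is, closed under addition) if and only if the following three conditions hold. (1) $\max([i]_m^{G})<\min([i]_m^{A})$ for all $i\in\{1,\ldots,m-1\}$ such that $h_i<\infty$, and $[m]_m^{G}$ is either empty or equal to $\{0\}$. (2) $h_i+h_j\geq h_{i+j}$ for all $i,j\in\{0,1,\ldots,m-1\}$ such that $h_i,h_j<\infty$. (3) For all $i,j\in\{0,\ldots,m-1\}$, if $h_i,h_j<\infty$ then $h_{i+j}<\infty$.
   Context: $\mathbb{N}_0$ is the set of non-negative integers. For $X\subseteq\mathbb{N}_0$, $[i]_m^{X}$ denotes the set of elements of $X$ congruent to $i$ modulo $m$. Conventions: $\inf(\emptyset)=\infty$; the maximum of an infinite subset of $\mathbb{N}_0$ is regarded as $\infty$ (so the strict inequality in (1) fails in that case). The index $i+j$ of $h_{i+j}$ is read modulo $m$, i.e. reduced to its residue in $\{0,\ldots,m-1\}$. *)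

theory Defs
  imports "HOL-Library.Extended_Nat" "HOL-Number_Theory.Cong"
begin

definition residue_part :: "nat \<Rightarrow> nat \<Rightarrow> nat set \<Rightarrow> nat set" where
  "residue_part i m X = {x \<in> X. [x = i] (mod m)}"

text \<open>
  The two notions below take values in \<^typ>\<open>enat\<close>: the infimum of the empty set is \<open>\<infinity>\<close>, and
  so is the maximum of an infinite set. The maximum of the empty set comes out as \<open>0\<close>.
\<close>

definition einf :: "nat set \<Rightarrow> enat" where
  "einf X = (INF x\<in>X. enat x)"

definition emax :: "nat set \<Rightarrow> enat" where
  "emax X = (SUP x\<in>X. enat x)"

lemma einf_empty: "einf {} = \<infinity>"
  by (simp add: einf_def top_enat_def)

lemma einf_nonempty:
  assumes "X \<noteq> {}"
  shows "einf X = enat (LEAST x. x \<in> X)"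
proof (rule antisym)
  have "(LEAST x. x \<in> X) \<in> X"
    using assms by (metis LeastI ex_in_conv)
  then show "einf X \<le> enat (LEAST x. x \<in> X)"
    unfolding einf_def by (rule INF_lower)
  show "enat (LEAST x. x \<in> X) \<le> einf X"
    unfolding einf_def by (rule INF_greatest) (simp add: Least_le)
qed

lemma emax_finite:
  assumes "finite X" "X \<noteq> {}"
  shows "emax X = enat (Max X)"
proof (rule antisym)
  show "emax X \<le> enat (Max X)"
    unfolding emax_def by (rule SUP_least) (simp add: assms)
  show "enat (Max X) \<le> emax X"
    unfolding emax_def by (rule SUP_upper) (simp add: assms)
qed

lemma emax_infinite:
  assumes "infinite X"
  shows "emax X = \<infinity>"
proof -
  have "infinite (enat ` X)"
    using assms by (simp add: finite_image_iff inj_on_def)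
  then show ?thesis
    by (auto simp: emax_def Sup_enat_def)
qed

definition additive_semigroup :: "nat set \<Rightarrow> bool" where
  "additive_semigroup S \<longleftrightarrow> (\<forall>x\<in>S. \<forall>y\<in>S. x + y \<in> S)"

end

theory Submission
  imports Defs
begin

text \<open>
  The theorem is the Kunz description of a semigroup by its least elements in the residue classes
  modulo $m$. The point that organises the proof is that \<open>h i\<close> is, uniformly in \<open>i\<close> with
  \<open>0 \<le> i < m\<close>, the least \<^emph>\<open>nonzero\<close> element of \<open>A\<close> in the class of \<open>i\<close>: for \<open>i = 0\<close> that element
  is \<open>m\<close> itself, by minimality of \<open>m\<close>, and the classes of the other \<open>i\<close> do not contain \<open>0\<close>. Leaving
  out \<open>0\<close> costs nothing, because adding \<open>0\<close> never leaves \<open>A\<close>.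

  With this reading, condition (1) says that each class, from its least nonzero element of \<open>A\<close>
  (if there is one) onwards, lies entirely in \<open>A\<close> (\<open>gap_condition_iff\<close>). Conditions (2) and (3)
  together say that \<open>h\<close> is subadditive with respect to addition of indices modulo \<open>m\<close>: in the
  extended naturals, \<open>h ((i + j) mod m) \<le> h i + h j\<close> makes the left-hand side finite whenever both
  summands are, and holds trivially when one of them is infinite. That these two properties
  characterise semigroups (\<open>additive_semigroup_iff_subadditive\<close>) is then short. If \<open>A\<close> is a semigroup,
  translation by \<open>m \<in> A\<close> fills each class upwards, and the sum of two least elements bounds the least
  element of the class of the sum. Conversely, for nonzero \<open>x, y \<in> A\<close>, subadditivity puts \<open>x + y\<close> at
  or above the least element of its class, hence in \<open>A\<close>.
\<close>

section \<open>Infima and maxima of residue classes\<close>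

lemma einf_le: "x \<in> X \<Longrightarrow> einf X \<le> enat x"
  unfolding einf_def by (rule INF_lower)

lemma einf_attained:
  assumes "einf X < \<infinity>"
  obtains x where "x \<in> X" "einf X = enat x"
proof -
  have "X \<noteq> {}"
    using assms by (auto simp: einf_empty)
  then show thesis
    using that einf_nonempty by (metis LeastI ex_in_conv)
qed

text \<open>
  The bound \<open>b\<close> must be positive because the maximum of the empty set is \<open>0\<close>.
\<close>

lemma emax_less_iff:
  assumes "0 < b"
  shows "emax X < enat b \<longleftrightarrow> (\<forall>x\<in>X. x < b)"
proof
  assume "emax X < enat b"
  then show "\<forall>x\<in>X. x < b"
    unfolding emax_def by (meson SUP_upper enat_ord_simps(2) order_le_less_trans)
next
  assume *: "\<forall>x\<in>X. x < b"
  then have fin: "finite X"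
    by (meson finite_nat_set_iff_bounded)
  show "emax X < enat b"
  proof (cases "X = {}")
    case True
    then show ?thesis
      using assms by (simp add: emax_def bot_enat_def zero_enat_def)
  next
    case False
    then show ?thesis
      using fin * by (simp add: emax_finite)
  qed
qed

lemma residue_part_remove_0:
  assumes "0 < i" "i < m"
  shows "residue_part i m (X - {0}) = residue_part i m X"
  using assms by (auto simp: residue_part_def cong_def intro: gr0I)

lemma einf_zero_class:
  assumes "m \<in> A" "0 < m"
  shows "einf (residue_part 0 m (A - {0})) = enat m"
proof (rule antisym)
  show "einf (residue_part 0 m (A - {0})) \<le> enat m"
    using assms by (intro einf_le) (simp add: residue_part_def cong_def)
  show "enat m \<le> einf (residue_part 0 m (A - {0}))"
    unfolding einf_def residue_part_def
    by (rule INF_greatest) (auto simp: cong_0_iff intro: dvd_imp_le)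
qed

section \<open>Semigroups and subadditive least elements\<close>

lemma additive_semigroup_iff_subadditive:
  fixes A :: "nat set" and h :: "nat \<Rightarrow> enat"
  assumes "m \<in> A" "0 < m"
    and h: "\<And>i. i < m \<Longrightarrow> h i = einf (residue_part i m (A - {0}))"
  shows "additive_semigroup A \<longleftrightarrow>
      (\<forall>x>0. h (x mod m) \<le> enat x \<longrightarrow> x \<in> A)
    \<and> (\<forall>i<m. \<forall>j<m. h ((i + j) mod m) \<le> h i + h j)"
    (is "_ \<longleftrightarrow> ?filled \<and> ?subadditive")
proof -
  have h_le: "h (x mod m) \<le> enat x" if "x \<in> A" "x \<noteq> 0" for x
    using that \<open>0 < m\<close> by (auto simp: h residue_part_def cong_def intro!: einf_le)
  have h_attained: "\<exists>a\<in>A - {0}. a mod m = i \<and> h i = enat a" if "i < m" "h i < \<infinity>" for i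
  proof -
    have "einf (residue_part i m (A - {0})) < \<infinity>"
      using that h by simp
    then obtain a where "a \<in> residue_part i m (A - {0})"
      "einf (residue_part i m (A - {0})) = enat a"
      by (rule einf_attained)
    then show ?thesis
      using that h[OF \<open>i < m\<close>] by (auto simp: residue_part_def cong_def)
  qed
  show ?thesis
  proof
    assume "additive_semigroup A"
    then have add: "x + y \<in> A" if "x \<in> A" "y \<in> A" for x y
      using that by (simp add: additive_semigroup_def)
    have translate: "a + q * m \<in> A" if "a \<in> A" for a q
    proof (induction q)
      case (Suc q)
      then show ?case
        using add[OF Suc \<open>m \<in> A\<close>] by (simp add: algebra_simps)
    qed (use that in simp)
    have ?filled
    proof (intro allI impI)
      fix x :: nat
      assume le: "h (x mod m) \<le> enat x"
      then have "h (x mod m) < \<infinity>"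
        by (metis enat_ord_code(4) order_le_less_trans)
      then obtain a where a: "a \<in> A" "a mod m = x mod m" "h (x mod m) = enat a"
        using h_attained \<open>0 < m\<close> by (metis DiffD1 mod_less_divisor)
      then have "a \<le> x"
        using le by simp
      then obtain q where "x = a + q * m"
        using a(2) by (metis mod_eq_nat2E mult.commute)
      then show "x \<in> A"
        using translate a(1) by simp
    qed
    moreover have ?subadditive
    proof (intro allI impI)
      fix i j
      assume ij: "i < m" "j < m"
      show "h ((i + j) mod m) \<le> h i + h j"
      proof (cases "h i < \<infinity> \<and> h j < \<infinity>")
        case True
        then obtain a b where a: "a \<in> A - {0}" "a mod m = i" "h i = enat a"
          and b: "b \<in> A - {0}" "b mod m = j" "h j = enat b"
          using h_attained ij by meson
        have "h ((a + b) mod m) \<le> enat (a + b)"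
          using a b add by (intro h_le) auto
        then show ?thesis
          using a b by (metis mod_add_eq plus_enat_simps(1))
      next
        case False
        then show ?thesis
          by auto
      qed
    qed
    ultimately show "?filled \<and> ?subadditive" ..
  next
    assume *: "?filled \<and> ?subadditive"
    show "additive_semigroup A"
      unfolding additive_semigroup_def
    proof (intro ballI)
      fix x y
      assume xy: "x \<in> A" "y \<in> A"
      show "x + y \<in> A"
      proof (cases "x = 0 \<or> y = 0")
        case True
        then show ?thesis
          using xy by auto
      next
        case False
        have "h ((x + y) mod m) = h ((x mod m + y mod m) mod m)"
          by (simp add: mod_add_eq)
        also have "\<dots> \<le> h (x mod m) + h (y mod m)"
          using * \<open>0 < m\<close> by simp
        also have "\<dots> \<le> enat x + enat y"
          using False xy h_le by (intro add_mono) auto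
        finally show ?thesis
          using * False by simp
      qed
    qed
  qed
qed

section \<open>Gaps below the least elements\<close>

text \<open>
  Both halves of condition (1) are instances of one statement about a single class: for the nonzero
  classes, all gaps lie below the least element of \<open>A\<close>; for the class of \<open>0\<close>, whose least nonzero
  element of \<open>A\<close> is the least positive multiple of \<open>m\<close>, there is no gap except possibly \<open>0\<close>.
\<close>

lemma gap_condition_iff:
  fixes A :: "nat set" and h :: "nat \<Rightarrow> enat"
  assumes "m \<in> A" "0 < m"
    and h: "\<And>i. i < m \<Longrightarrow> h i = einf (residue_part i m (A - {0}))"
  shows "((\<forall>i\<in>{1..<m}. h i < \<infinity> \<longrightarrow>
             emax (residue_part i m (- A)) < einf (residue_part i m A))
          \<and> (residue_part m m (- A) = {} \<or> residue_part m m (- A) = {0}))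
     \<longleftrightarrow> (\<forall>x>0. h (x mod m) \<le> enat x \<longrightarrow> x \<in> A)"
    (is "?nonzero \<and> ?zero \<longleftrightarrow> ?filled")
proof -
  have class_iff: "(h i < \<infinity> \<longrightarrow> emax (residue_part i m (- A)) < einf (residue_part i m A))
      \<longleftrightarrow> (\<forall>x. x mod m = i \<longrightarrow> h i \<le> enat x \<longrightarrow> x \<in> A)" if i: "i \<in> {1..<m}" for i
  proof (cases "h i < \<infinity>")
    case True
    have h_i: "h i = einf (residue_part i m A)"
      using i h by (simp add: residue_part_remove_0)
    then have "einf (residue_part i m A) < \<infinity>"
      using True by simp
    then obtain a where a: "a \<in> residue_part i m A" "einf (residue_part i m A) = enat a"
      by (rule einf_attained)
    then have "0 < a"
      using i by (auto simp: residue_part_def cong_def intro: gr0I)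
    then have "emax (residue_part i m (- A)) < enat a
        \<longleftrightarrow> (\<forall>x\<in>residue_part i m (- A). x < a)"
      by (rule emax_less_iff)
    then show ?thesis
      using True a i h_i by (auto simp: residue_part_def cong_def not_less[symmetric])
  next
    case False
    then show ?thesis
      by auto
  qed
  have zero_iff: "?zero \<longleftrightarrow> (\<forall>x>0. x mod m = 0 \<longrightarrow> h 0 \<le> enat x \<longrightarrow> x \<in> A)"
  proof -
    have "h 0 = enat m"
      using assms by (simp add: einf_zero_class)
    moreover have "enat m \<le> enat x" if "0 < x" "x mod m = 0" for x
      using that by (auto intro: dvd_imp_le)
    moreover have "?zero \<longleftrightarrow> (\<forall>x>0. x mod m = 0 \<longrightarrow> x \<in> A)"
    proof -
      have "?zero \<longleftrightarrow> residue_part m m (- A) \<subseteq> {0}"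
        by (simp only: subset_singleton_iff)
      also have "\<dots> \<longleftrightarrow> (\<forall>x>0. x mod m = 0 \<longrightarrow> x \<in> A)"
        by (auto simp: residue_part_def cong_def)
      finally show ?thesis .
    qed
    ultimately show ?thesis
      by metis
  qed
  show ?thesis
  proof
    assume L: "?nonzero \<and> ?zero"
    show ?filled
    proof (intro allI impI)
      fix x :: nat
      assume x: "0 < x" "h (x mod m) \<le> enat x"
      show "x \<in> A"
      proof (cases "x mod m = 0")
        case True
        then show ?thesis
          using L zero_iff x by metis
      next
        case False
        then have "x mod m \<in> {1..<m}"
          using \<open>0 < m\<close> by simp
        then show ?thesis
          using L class_iff x by blast
      qed
    qed
  next
    assume R: ?filled
    have "\<forall>x. x mod m = i \<longrightarrow> h i \<le> enat x \<longrightarrow> x \<in> A" if "i \<in> {1..<m}" for i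
    proof (intro allI impI)
      fix x
      assume x: "x mod m = i" "h i \<le> enat x"
      then have "0 < x"
        using that by (auto intro: gr0I)
      then show "x \<in> A"
        using R x by blast
    qed
    then have ?nonzero
      using class_iff by blast
    moreover have ?zero
      unfolding zero_iff using R by metis
    ultimately show "?nonzero \<and> ?zero" ..
  qed
qed

section \<open>The characterisation of semigroups\<close>

theorem theorem11:
  fixes G A :: "nat set" and m :: nat and h :: "nat \<Rightarrow> enat"
  assumes "G \<noteq> {}" and "G \<subset> UNIV"
    and "A = UNIV - G" and "A - {0} \<noteq> {}"
    and "m = (LEAST n. n \<in> A - {0})"
    and "h 0 = enat m"
    and "\<And>i. i \<in> {1..<m} \<Longrightarrow> h i = einf (residue_part i m A)"
  shows "additive_semigroup A \<longleftrightarrow>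
      ((\<forall>i\<in>{1..<m}. h i < \<infinity> \<longrightarrow> emax (residue_part i m G) < einf (residue_part i m A))
          \<and> (residue_part m m G = {} \<or> residue_part m m G = {0}))
    \<and> (\<forall>i\<in>{0..<m}. \<forall>j\<in>{0..<m}. h i < \<infinity> \<and> h j < \<infinity> \<longrightarrow> h i + h j \<ge> h ((i + j) mod m))
    \<and> (\<forall>i\<in>{0..<m}. \<forall>j\<in>{0..<m}. h i < \<infinity> \<and> h j < \<infinity> \<longrightarrow> h ((i + j) mod m) < \<infinity>)"
proof -
  have "m \<in> A - {0}"
    using assms(4,5) by (metis LeastI ex_in_conv)
  then have m: "m \<in> A" "0 < m"
    by auto
  have G: "G = - A"
    using assms(3) by auto
  have h: "h i = einf (residue_part i m (A - {0}))" if "i < m" for i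
    using that m assms(6,7) by (cases "i = 0") (auto simp: einf_zero_class residue_part_remove_0)
  have subadditive_iff: "(\<forall>i<m. \<forall>j<m. h ((i + j) mod m) \<le> h i + h j) \<longleftrightarrow>
      (\<forall>i\<in>{0..<m}. \<forall>j\<in>{0..<m}. h i < \<infinity> \<and> h j < \<infinity> \<longrightarrow> h i + h j \<ge> h ((i + j) mod m))
    \<and> (\<forall>i\<in>{0..<m}. \<forall>j\<in>{0..<m}. h i < \<infinity> \<and> h j < \<infinity> \<longrightarrow> h ((i + j) mod m) < \<infinity>)"
    (is "?sub \<longleftrightarrow> ?two \<and> ?three")
  proof
    assume ?sub
    moreover have "u < \<infinity>" if "u \<le> v + w" "v < \<infinity>" "w < \<infinity>" for u v w :: enat
      using that by (cases u; cases v; cases w) auto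
    ultimately show "?two \<and> ?three"
      by (meson atLeastLessThan_iff)
  next
    assume two: "?two \<and> ?three"
    show ?sub
    proof (intro allI impI)
      fix i j
      assume "i < m" "j < m"
      then show "h ((i + j) mod m) \<le> h i + h j"
        using two by (cases "h i < \<infinity> \<and> h j < \<infinity>") auto
    qed
  qed
  note semigroup = additive_semigroup_iff_subadditive[of m A h, OF m]
    and gaps = gap_condition_iff[of m A h, OF m]
  show ?thesis
    by (subst semigroup, erule h, subst subadditive_iff, unfold G, subst gaps, erule h, rule refl)
qed

end
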